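(* Let $p\ge 0$ and $l\ge 2$ be integers, let $t_{-p}<t_{-p+1}<\cdots<t_{l+p}$ be real knots, let $\boldsymbol{\alpha}=(\alpha_1,\dots,\alpha_{p+l})^\top\in\mathbb{R}^{l+p}$, and let $s=\sum_{j=-p}^{l-1}\alpha_{j+p+1}B^{(p)}_j$. Then, for each $i\in\{1,\dots,l-1\}$, $s$ does not use the $i$-th knot $t_i$ if and only if $(\boldsymbol{D}^{(p+1)}\boldsymbol{\alpha})_i=0$.
   Context: B-spline basis functions. For knots $t_{-p}<t_{-p+1}<\cdots<t_{l+p}$, set $B^{(0)}_j(x)=1$ if $t_j\le x<t_{j+1}$ and $B^{(0)}_j(x)=0$ otherwise, for $j=-p,\dots,l+p-1$; and for $q=1,\dots,p$ and $j=-p,\dots,l+p-q-1$ set $$B^{(q)}_{j}(x)=\frac{x-t_{j}}{t_{j+q}-t_{j}}B^{(q-1)}_{j}(x)+\frac{t_{j+q+1}-x}{t_{j+q+1}-t_{j+1}}B^{(q-1)}_{j+1}(x).$$ The function $s$ is considered on $[t_0,t_l)$. The restrictions of $B^{(p)}_{-p},\dots,B^{(p)}_{l-1}$ to $[t_0,t_l)$ form a basis of the space of piecewise polynomials of degree at most $p$ with breakpoints $t_1,\dots,t_{l-1}$ whose derivatives up to order $p-1$ agree at all breakpoints. "$s$ does not use the $i$-th knot $t_i$" ($1\le i\le l-1$) means that $t_i$ is not needed as a breakpoint of $s$: $s$ coincides on $[t_{i-1},t_{i+1})$ with a single polynomial of degree at most $p$. Difference matrices. $\boldsymbol{D}^{(1)}\in\mathbb{R}^{(l-1)\times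 l}$ has $(i,i)$ entry $-1$, $(i,i+1)$ entry $1$ for $i=1,\dots,l-1$, and all other entries $0$. For $1\le q\le p$, $\boldsymbol{\Delta}^{(q+1)}\in\mathbb{R}^{(l-1+q)\times(l+q)}$ is the matrix whose $r$-th row ($r=1,\dots,l-1+q$) has entry $-\frac{1}{t_r-t_{r-q}}$ in column $r$, entry $\frac{1}{t_r-t_{r-q}}$ in column $r+1$, and zeros elsewhere; and $\boldsymbol{D}^{(q+1)}=\boldsymbol{D}^{(q)}\boldsymbol{\Delta}^{(q+1)}\in\mathbb{R}^{(l-1)\times(l+q)}$. *)

theory Defs
  imports Complex_Main "HOL-Computational_Algebra.Polynomial" "Jordan_Normal_Form.Matrix"
begin

text \<open>
  Knots are a function \<open>t :: int \<Rightarrow> real\<close>, of which only the values at the indices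
  \<open>-p, \<dots>, l + p\<close> matter. \<open>bspline t q j\<close> is \<open>B\<^sup>(\<^sup>q\<^sup>)\<^sub>j\<close>; it only looks at the knots
  with indices \<open>j, \<dots>, j + q + 1\<close>.
\<close>

primrec bspline :: "(int \<Rightarrow> real) \<Rightarrow> nat \<Rightarrow> int \<Rightarrow> real \<Rightarrow> real" where
  "bspline t 0 j x = (if t j \<le> x \<and> x < t (j + 1) then 1 else 0)"
| "bspline t (Suc q) j x =
     (x - t j) / (t (j + int (Suc q)) - t j) * bspline t q j x
     + (t (j + int (Suc q) + 1) - x) / (t (j + int (Suc q) + 1) - t (j + 1))
         * bspline t q (j + 1) x"

text \<open>
  Vectors and matrices of \<^theory>\<open>Jordan_Normal_Form.Matrix\<close> are indexed from 0, so the
  coefficient with the 1-based index \<open>j + p + 1\<close> is the entry \<open>nat (j + p)\<close>.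
\<close>

definition spline :: "(int \<Rightarrow> real) \<Rightarrow> nat \<Rightarrow> nat \<Rightarrow> real vec \<Rightarrow> real \<Rightarrow> real" where
  "spline t p l \<alpha> x = (\<Sum>j\<in>{- int p..int l - 1}. \<alpha> $ nat (j + int p) * bspline t p j x)"

definition uses_knot :: "(int \<Rightarrow> real) \<Rightarrow> nat \<Rightarrow> (real \<Rightarrow> real) \<Rightarrow> int \<Rightarrow> bool" where
  "uses_knot t p s i \<longleftrightarrow>
     \<not> (\<exists>P :: real poly. degree P \<le> p \<and> (\<forall>x\<in>{t (i - 1)..<t (i + 1)}. s x = poly P x))"

text \<open>
  \<open>Delta_mat t l m\<close> is \<open>\<Delta>\<^sup>(\<^sup>m\<^sup>)\<close>, meant for \<open>m \<ge> 2\<close>. The 0-based row \<open>r\<close> is the 1-based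
  row \<open>r + 1\<close>, whence the shift by one in the knot indices.
\<close>

fun Delta_mat :: "(int \<Rightarrow> real) \<Rightarrow> nat \<Rightarrow> nat \<Rightarrow> real mat" where
  "Delta_mat t l (Suc q) = mat (l - 1 + q) (l + q) (\<lambda>(r, c).
     if c = r then - (1 / (t (int r + 1) - t (int r + 1 - int q)))
     else if c = r + 1 then 1 / (t (int r + 1) - t (int r + 1 - int q))
     else 0)"

text \<open>\<open>D_mat t l m\<close> is \<open>D\<^sup>(\<^sup>m\<^sup>)\<close>, defined for \<open>m \<ge> 1\<close> and unspecified for \<open>m = 0\<close>.\<close>

fun D_mat :: "(int \<Rightarrow> real) \<Rightarrow> nat \<Rightarrow> nat \<Rightarrow> real mat" where
  "D_mat t l (Suc 0) = mat (l - 1) l (\<lambda>(r, c). if c = r then - 1 else if c = r + 1 then 1 else 0)"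
| "D_mat t l (Suc (Suc q)) = D_mat t l (Suc q) * Delta_mat t l (Suc (Suc q))"

end

theory Submission
  imports Defs
begin

text \<open>
  On each knot interval a B-spline is a polynomial, so the spline \<open>s\<close> does not use \<open>t\<^sub>i\<close> exactly
  when the polynomials \<open>L\<close> and \<open>R\<close> that it follows immediately to the left and to the right of
  \<open>t\<^sub>i\<close> are equal. Both have degree at most \<open>p\<close> and they agree to order \<open>p - 1\<close> at \<open>t\<^sub>i\<close>, so that
  \<open>R - L\<close> is a multiple of \<open>(x - t\<^sub>i)\<^sup>p\<close>; everything rests on identifying the factor as
  \<open>(D\<^sup>(\<^sup>p\<^sup>+\<^sup>1\<^sup>) \<alpha>)\<^sub>i\<close>, with constant exactly one.

  No derivatives are needed for this. Let \<open>c\<^sub>q\<^sub>,\<^sub>j\<close> be the factor for a single \<open>B\<^sup>(\<^sup>q\<^sup>)\<^sub>j\<close>.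
  Comparing leading coefficients in the recursion that defines the B-splines gives
  \<open>c\<^sub>q\<^sub>+\<^sub>1\<^sub>,\<^sub>j = a\<^sub>q\<^sub>,\<^sub>j - a\<^sub>q\<^sub>,\<^sub>j\<^sub>+\<^sub>1\<close>, where \<open>a\<^sub>q\<^sub>,\<^sub>j = c\<^sub>q\<^sub>,\<^sub>j / (t\<^sub>j\<^sub>+\<^sub>q\<^sub>+\<^sub>1 - t\<^sub>j)\<close>, and right multiplication
  by \<open>\<Delta>\<^sup>(\<^sup>q\<^sup>+\<^sup>2\<^sup>)\<close> acts on the rows of \<open>D\<^sup>(\<^sup>q\<^sup>+\<^sup>1\<^sup>)\<close> by the same rule (lemma \<open>D_mat_eq_knot_jump\<close>).
  That the difference of the two pieces really keeps the form \<open>c (x - t\<^sub>i)\<^sup>q\<close> amounts to the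
  two-term identity of lemma \<open>knot_jump_balance\<close>, which reproduces itself under the recursion;
  this yields lemma \<open>bspline_piece_jump\<close>.
\<close>

(* leaves smult as the scalar multiplication of polynomials *)
hide_const (open) module.smult

section \<open>Polynomial pieces of B-splines\<close>

text \<open>
  The piece of \<open>B\<^sup>(\<^sup>q\<^sup>)\<^sub>j\<close> on \<open>[t\<^sub>k, t\<^sub>k\<^sub>+\<^sub>1)\<close>: on that interval the degree-zero
  B-splines are constant, and the recursion for higher degrees has polynomial coefficients.
\<close>

primrec bspline_piece :: "(int \<Rightarrow> real) \<Rightarrow> int \<Rightarrow> nat \<Rightarrow> int \<Rightarrow> real poly" where
  "bspline_piece t k 0 j = (if j = k then 1 else 0)"
| "bspline_piece t k (Suc q) j =
     smult (1 / (t (j + int q + 1) - t j)) ([:- t j, 1:] * bspline_piece t k q j)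
     + smult (1 / (t (j + int q + 2) - t (j + 1)))
         ([:t (j + int q + 2), - 1:] * bspline_piece t k q (j + 1))"

lemma degree_bspline_piece: "degree (bspline_piece t k q j) \<le> q"
proof (induction q arbitrary: j)
  case 0
  then show ?case by simp
next
  case (Suc q)
  have linear: "degree ([:a, b:] * bspline_piece t k q m) \<le> Suc q" for a b m
    using degree_mult_le[of "[:a, b:]" "bspline_piece t k q m"] Suc[of m] by (auto split: if_splits)
  show ?case
    unfolding bspline_piece.simps
    by (intro degree_add_le order_trans[OF degree_smult_le] linear)
qed

lemma bspline_eq_piece:
  assumes mono: "strict_mono_on {a..b} t"
    and k: "a \<le> k" "k + 1 \<le> b" and x: "t k \<le> x" "x < t (k + 1)"
    and j: "a \<le> j" "j + int q + 1 \<le> b"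
  shows "bspline t q j x = poly (bspline_piece t k q j) x"
  using j
proof (induction q arbitrary: j)
  case 0
  have "t j \<le> x \<and> x < t (j + 1) \<longleftrightarrow> j = k"
  proof
    assume *: "t j \<le> x \<and> x < t (j + 1)"
    have le: "t m \<le> t n" if "a \<le> m" "m \<le> n" "n \<le> b" for m n
      using strict_mono_on_leD[OF mono, of m n] that by auto
    show "j = k"
    proof (rule linorder_cases[of j k])
      assume "j < k"
      then show ?thesis using le[of "j + 1" k] * x 0 k by auto
    next
      assume "k < j"
      then show ?thesis using le[of "k + 1" j] * x 0 k by auto
    qed auto
  qed (use x in auto)
  then show ?case by simp
next
  case (Suc q)
  then show ?case by (simp add: algebra_simps add_divide_distrib diff_divide_distrib)
qed

section \<open>The jump of a B-spline across a knot\<close>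

text \<open>
  The factor \<open>c\<close> such that the piece of \<open>B\<^sup>(\<^sup>q\<^sup>)\<^sub>j\<close> to the right of \<open>t\<^sub>i\<close> exceeds the piece
  to the left by \<open>c (x - t\<^sub>i)\<^sup>q\<close>. In degree zero the B-spline rises from 0 to 1 at the left
  end of its support and falls back to 0 at the right end; the recursion equates the coefficients
  of \<open>x\<^sup>q\<^sup>+\<^sup>1\<close> in the recursion for \<open>B\<^sup>(\<^sup>q\<^sup>+\<^sup>1\<^sup>)\<^sub>j\<close>.
\<close>

primrec knot_jump :: "(int \<Rightarrow> real) \<Rightarrow> int \<Rightarrow> nat \<Rightarrow> int \<Rightarrow> real" where
  "knot_jump t i 0 j = (if j = i then 1 else if j = i - 1 then - 1 else 0)"
| "knot_jump t i (Suc q) j =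
     knot_jump t i q j / (t (j + int q + 1) - t j)
     - knot_jump t i q (j + 1) / (t (j + int q + 2) - t (j + 1))"

lemma knot_jump_outside_support:
  "i < j \<or> j + int q + 1 < i \<Longrightarrow> knot_jump t i q j = 0"
  by (induction q arbitrary: j) auto

text \<open>
  This says that the linear polynomial multiplying \<open>(x - t\<^sub>i)\<^sup>q\<close> in the recursion for the jump of
  \<open>B\<^sup>(\<^sup>q\<^sup>+\<^sup>1\<^sup>)\<^sub>j\<close> vanishes at \<open>t\<^sub>i\<close>, which gains one order of smoothness. In the induction step,
  writing the identity for \<open>q\<close> as \<open>(t\<^sub>j - t\<^sub>i) a\<^sub>j = (t\<^sub>j\<^sub>+\<^sub>q\<^sub>+\<^sub>2 - t\<^sub>i) a\<^sub>j\<^sub>+\<^sub>1\<close>, both sides of the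
  identity for \<open>q + 1\<close> collapse to \<open>a\<^sub>j\<^sub>+\<^sub>1\<close>.
\<close>

lemma knot_jump_balance:
  assumes inj: "inj_on t {a..b}" and "a \<le> j" "j + int q + 2 \<le> b"
  shows "(t j - t i) * (knot_jump t i q j / (t (j + int q + 1) - t j))
    = (t (j + int q + 2) - t i) * (knot_jump t i q (j + 1) / (t (j + int q + 2) - t (j + 1)))"
  using assms(2,3)
proof (induction q arbitrary: j)
  case 0
  have ne: "t (j + 1) \<noteq> t j" "t (j + 2) \<noteq> t (j + 1)"
    using inj_onD[OF inj, of "j + 1" j] inj_onD[OF inj, of "j + 2" "j + 1"] 0 by auto
  consider "j = i" | (left) "i = j + 1" | "i = j + 2" | "j \<noteq> i" "i \<noteq> j + 1" "i \<noteq> j + 2"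
    by blast
  then show ?case
  proof cases
    case left
    then show ?thesis using ne by (simp add: divide_simps)
  qed auto
next
  case (Suc q)
  define a0 where "a0 = knot_jump t i q j / (t (j + int q + 1) - t j)"
  define a1 where "a1 = knot_jump t i q (j + 1) / (t (j + int q + 2) - t (j + 1))"
  define a2 where "a2 = knot_jump t i q (j + 2) / (t (j + int q + 3) - t (j + 2))"
  have ne: "t (j + int q + 2) - t j \<noteq> 0" "t (j + int q + 3) - t (j + 1) \<noteq> 0"
    using inj_onD[OF inj, of "j + int q + 2" j] inj_onD[OF inj, of "j + int q + 3" "j + 1"] Suc.prems
    by auto
  have IH0: "(t j - t i) * a0 = (t (j + int q + 2) - t i) * a1"
    using Suc.IH[of j] Suc.prems by (simp add: a0_def a1_def add_ac)
  have IH1: "(t (j + 1) - t i) * a1 = (t (j + int q + 3) - t i) * a2"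
    using Suc.IH[of "j + 1"] Suc.prems by (simp add: a1_def a2_def add_ac)
  have "(t j - t i) * ((a0 - a1) / (t (j + int q + 2) - t j)) = a1"
    using IH0 ne(1) by (simp add: divide_simps) (simp add: algebra_simps)
  moreover have "(t (j + int q + 3) - t i) * ((a1 - a2) / (t (j + int q + 3) - t (j + 1))) = a1"
    using IH1 ne(2) by (simp add: divide_simps) (simp add: algebra_simps)
  moreover have "knot_jump t i (Suc q) j = a0 - a1"
    by (simp add: a0_def a1_def)
  moreover have "knot_jump t i (Suc q) (j + 1) = a1 - a2"
    by (simp add: a1_def a2_def add_ac)
  ultimately show ?case by (simp add: add_ac del: knot_jump.simps)
qed

text \<open>
  With the induction hypothesis the jump of \<open>B\<^sup>(\<^sup>q\<^sup>+\<^sup>1\<^sup>)\<^sub>j\<close> is \<open>(x - t\<^sub>i)\<^sup>q\<close> times a linear polynomial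
  with leading coefficient \<open>c\<^sub>q\<^sub>+\<^sub>1\<^sub>,\<^sub>j\<close>, and by \<open>knot_jump_balance\<close> that polynomial has its root
  at \<open>t\<^sub>i\<close>.
\<close>

lemma bspline_piece_jump:
  assumes inj: "inj_on t {a..b}" and "a \<le> j" "j + int q + 1 \<le> b"
  shows "bspline_piece t i q j - bspline_piece t (i - 1) q j
    = smult (knot_jump t i q j) ([:- t i, 1:] ^ q)"
  using assms(2,3)
proof (induction q arbitrary: j)
  case 0
  then show ?case by (simp add: one_pCons)
next
  case (Suc q)
  define d0 where "d0 = t (j + int q + 1) - t j"
  define d1 where "d1 = t (j + int q + 2) - t (j + 1)"
  define a0 where "a0 = knot_jump t i q j / d0"
  define a1 where "a1 = knot_jump t i q (j + 1) / d1"
  define X where "X = [:- t i, 1:] ^ q"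
  have IH0: "bspline_piece t i q j - bspline_piece t (i - 1) q j = smult (knot_jump t i q j) X"
    and IH1: "bspline_piece t i q (j + 1) - bspline_piece t (i - 1) q (j + 1)
      = smult (knot_jump t i q (j + 1)) X"
    using Suc.IH[of j] Suc.IH[of "j + 1"] Suc.prems by (auto simp: X_def)
  have balance: "(t j - t i) * a0 = (t (j + int q + 2) - t i) * a1"
    using knot_jump_balance[OF inj, of j q i] Suc.prems
    by (simp add: a0_def a1_def d0_def d1_def add_ac)
  have "bspline_piece t i (Suc q) j - bspline_piece t (i - 1) (Suc q) j
    = smult (1 / d0) ([:- t j, 1:] * (bspline_piece t i q j - bspline_piece t (i - 1) q j))
    + smult (1 / d1) ([:t (j + int q + 2), - 1:]
        * (bspline_piece t i q (j + 1) - bspline_piece t (i - 1) q (j + 1)))"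
    unfolding bspline_piece.simps d0_def d1_def right_diff_distrib smult_diff_right by simp
  also have "\<dots> = (smult a0 [:- t j, 1:] + smult a1 [:t (j + int q + 2), - 1:]) * X"
    unfolding IH0 IH1 by (simp add: a0_def a1_def distrib_right del: mult_pCons_left smult_pCons)
  also have "smult a0 [:- t j, 1:] + smult a1 [:t (j + int q + 2), - 1:]
      = smult (a0 - a1) [:- t i, 1:]"
    using balance by (simp add: algebra_simps)
  also have "a0 - a1 = knot_jump t i (Suc q) j"
    by (simp add: a0_def a1_def d0_def d1_def)
  finally show ?case by (simp only: X_def power_Suc mult_smult_left)
qed

section \<open>Difference matrices\<close>

lemma dim_D_mat: "dim_row (D_mat t l (Suc q)) = l - 1" "dim_col (D_mat t l (Suc q)) = l + q"
  by (induction q) auto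

text \<open>
  Column \<open>c\<close> of \<open>\<Delta>\<close> has its only nonzero entries in the rows \<open>c - 1\<close> and \<open>c\<close>. In the first and
  the last column one of these rows does not exist; there the corresponding B-spline does not
  have \<open>t\<^sub>i\<close> in its support, because \<open>0 < i < l\<close>, so that the missing term is zero.
\<close>

lemma D_mat_eq_knot_jump:
  assumes i: "1 \<le> i" "i \<le> l - 1" and "c < l + q"
  shows "D_mat t l (Suc q) $$ (i - 1, c) = knot_jump t (int i) q (int c - int q)"
  using assms(3)
proof (induction q arbitrary: c)
  case 0
  have "c = i - 1 \<longleftrightarrow> int c = int i - 1" "i - 1 + 1 = i" using i by auto
  with 0 i show ?case by auto
next
  case (Suc q)
  define f where "f r = knot_jump t (int i) q (int r - int q)" for r
  define d where "d r = t (int r + 1) - t (int r - int q)" for r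
  (* minus A and B are the contributions of the rows c and c - 1 *)
  define A where "A = (if c < l + q then f c / d c else 0)"
  define B where "B = (if c = 0 then 0 else f (c - 1) / d (c - 1))"
  have rows: "dim_row (Delta_mat t l (Suc (Suc q))) = l + q"
      "dim_col (Delta_mat t l (Suc (Suc q))) = l + Suc q"
      "l - 1 + Suc q = l + q"
    using i by auto
  have "i < l" using i by linarith
  have IH: "D_mat t l (Suc q) $$ (i - Suc 0, r) = f r" if "r < l + q" for r
    using Suc.IH[OF that] by (simp add: f_def)
  have row: "int r + 1 - int (Suc q) = int r - int q" for r by simp
  have "D_mat t l (Suc (Suc q)) $$ (i - 1, c)
    = (\<Sum>r<l + q. D_mat t l (Suc q) $$ (i - 1, r) * Delta_mat t l (Suc (Suc q)) $$ (r, c))"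
    using Suc.prems i rows
    by (simp add: scalar_prod_def dim_D_mat lessThan_atLeast0 del: D_mat.simps(1) Delta_mat.simps)
  also have "\<dots> = (\<Sum>r<l + q. (if r = c then - (f r / d r) else 0)
      + (if Suc r = c then f r / d r else 0))"
    using Suc.prems i rows(3) by (intro sum.cong refl) (auto simp: IH d_def row simp del: D_mat.simps)
  also have "\<dots> = B - A"
  proof -
    have "(\<Sum>r<l + q. if Suc r = c then f r / d r else 0) = B"
    proof (cases c)
      case (Suc m)
      then show ?thesis using Suc.prems by (simp add: B_def)
    qed (simp add: B_def)
    then show ?thesis by (simp add: sum.distrib A_def)
  qed
  also have "A = knot_jump t (int i) q (int c - int q) / (t (int c + 1) - t (int c - int q))"
    using knot_jump_outside_support[of "int i" "int c - int q" q t] \<open>i < l\<close>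
    by (cases "c < l + q") (auto simp: A_def f_def d_def)
  also have "B = knot_jump t (int i) q (int c - int q - 1) / (t (int c) - t (int c - int q - 1))"
    using knot_jump_outside_support[of "int i" "int c - int q - 1" q t] i
    by (cases c) (auto simp: B_def f_def d_def algebra_simps)
  finally show ?case by (simp add: algebra_simps)
qed

section \<open>The characterization of unused knots\<close>

lemma poly_eqI_on_interval:
  fixes P Q :: "real poly"
  assumes "u < v" and "\<And>x. u \<le> x \<Longrightarrow> x < v \<Longrightarrow> poly P x = poly Q x"
  shows "P = Q"
proof (rule ccontr)
  assume "P \<noteq> Q"
  then have "finite {x. poly (P - Q) x = 0}" by (intro poly_roots_finite) simp
  moreover have "{u<..<v} \<subseteq> {x. poly (P - Q) x = 0}" using assms(2) by auto
  ultimately show False using infinite_Ioo[OF assms(1)] finite_subset by blast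
qed

theorem theorem2p1:
  fixes t :: "int \<Rightarrow> real" and p l i :: nat and \<alpha> :: "real vec"
  assumes "l \<ge> 2"
    and "strict_mono_on {- int p..int l + int p} t"
    and "\<alpha> \<in> carrier_vec (l + p)"
    and "i \<in> {1..l - 1}"
  shows "\<not> uses_knot t p (spline t p l \<alpha>) (int i) \<longleftrightarrow> (D_mat t l (p + 1) *\<^sub>v \<alpha>) $ (i - 1) = 0"
proof -
  define s where "s = spline t p l \<alpha>"
  define J where "J = {- int p..int l - 1}"
  define S where
    "S k = (\<Sum>j\<in>J. smult (\<alpha> $ nat (j + int p)) (bspline_piece t k p j))" for k
  define c where "c = (D_mat t l (p + 1) *\<^sub>v \<alpha>) $ (i - 1)"
  have i: "1 \<le> i" "i \<le> l - 1" using assms(4) by auto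
  note mono = assms(2)
  have inj: "inj_on t {- int p..int l + int p}"
    using mono by (rule strict_mono_on_imp_inj_on)
  have less: "t (int i - 1) < t (int i)" "t (int i) < t (int i + 1)"
    using strict_mono_onD[OF mono, of "int i - 1" "int i"]
      strict_mono_onD[OF mono, of "int i" "int i + 1"] i assms(1) by auto
  have s_eq: "s x = poly (S k) x"
    if "k \<in> {int i - 1, int i}" "t k \<le> x" "x < t (k + 1)" for k x
  proof -
    have "bspline t p j x = poly (bspline_piece t k p j) x" if "j \<in> J" for j
      using that \<open>k \<in> _\<close> i assms(1)
      by (intro bspline_eq_piece[OF mono _ _ \<open>t k \<le> x\<close> \<open>x < t (k + 1)\<close>]) (auto simp: J_def)
    then show ?thesis
      by (simp add: s_def spline_def S_def poly_sum flip: J_def)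
  qed
  have "c = (\<Sum>m<l + p. \<alpha> $ m * knot_jump t (int i) p (int m - int p))"
    using assms(3) i D_mat_eq_knot_jump[OF i, of _ p t]
    by (auto simp: c_def scalar_prod_def dim_D_mat lessThan_atLeast0 mult.commute
        intro!: sum.cong simp del: D_mat.simps)
  also have "\<dots> = (\<Sum>j\<in>J. \<alpha> $ nat (j + int p) * knot_jump t (int i) p j)"
    by (rule sum.reindex_bij_witness[of _ "\<lambda>j. nat (j + int p)" "\<lambda>m. int m - int p"])
      (auto simp: J_def)
  finally have c_sum: "c = (\<Sum>j\<in>J. \<alpha> $ nat (j + int p) * knot_jump t (int i) p j)" .
  have "S (int i) - S (int i - 1) = (\<Sum>j\<in>J. smult (\<alpha> $ nat (j + int p))
      (bspline_piece t (int i) p j - bspline_piece t (int i - 1) p j))"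
    by (simp add: S_def sum_subtractf smult_diff_right)
  also have "\<dots> = (\<Sum>j\<in>J. smult (\<alpha> $ nat (j + int p) * knot_jump t (int i) p j) ([:- t (int i), 1:] ^ p))"
    by (intro sum.cong refl) (subst bspline_piece_jump[OF inj], auto simp: J_def)
  also have "\<dots> = smult c ([:- t (int i), 1:] ^ p)"
    by (simp add: c_sum smult_sum)
  finally have jump: "S (int i) - S (int i - 1) = smult c ([:- t (int i), 1:] ^ p)" .
  have "\<not> uses_knot t p s (int i) \<longleftrightarrow> S (int i) = S (int i - 1)"
  proof
    assume "\<not> uses_knot t p s (int i)"
    then obtain P where P: "\<And>x. t (int i - 1) \<le> x \<Longrightarrow> x < t (int i + 1) \<Longrightarrow> s x = poly P x"
      unfolding uses_knot_def by auto
    have "P = S (int i - 1)"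
      by (rule poly_eqI_on_interval[OF less(1)]) (use P s_eq[of "int i - 1"] less in force)
    moreover have "P = S (int i)"
      by (rule poly_eqI_on_interval[OF less(2)]) (use P s_eq[of "int i"] less in force)
    ultimately show "S (int i) = S (int i - 1)" by simp
  next
    assume eq: "S (int i) = S (int i - 1)"
    have "degree (S (int i)) \<le> p"
      unfolding S_def J_def
      by (intro degree_sum_le order_trans[OF degree_smult_le] degree_bspline_piece) auto
    moreover have "s x = poly (S (int i)) x" if "t (int i - 1) \<le> x" "x < t (int i + 1)" for x
      using that s_eq[of "int i" x] s_eq[of "int i - 1" x] eq by (cases "x < t (int i)") auto
    ultimately show "\<not> uses_knot t p s (int i)"
      unfolding uses_knot_def by auto
  qed
  also have "\<dots> \<longleftrightarrow> smult c ([:- t (int i), 1:] ^ p) = 0"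
    by (simp flip: jump)
  also have "\<dots> \<longleftrightarrow> c = 0" by simp
  finally show ?thesis by (simp only: s_def c_def)
qed

end
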